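(* Let $R$ be an abelian ring. The following are equivalent: (1) $R$ is unit-regular (equivalently, special clean); (2) $R$ is uniquely special clean.
   Context: Rings are associative with identity. A ring is abelian if all of its idempotents are central. A ring $R$ is unit-regular if for each $a\in R$ there is a unit $u\in R$ with $a=aua$. A special clean decomposition of $a\in R$ is an expression $a=u+e$ with $u$ a unit, $e$ an idempotent, and $aR\cap eR=0$. $R$ is special clean if every element has a special clean decomposition, and uniquely special clean if every element has exactly one special clean decomposition. (By a theorem of Camillo and Khurana, a ring is unit-regular if and only if it is special clean.) *)

theory Defs
  imports "HOL-Algebra.Ring" "HOL-Algebra.Coset"
begin

definition idempotent_elems :: "('a, 'b) ring_scheme \<Rightarrow> 'a set" where
  "idempotent_elems R = {e \<in> carrier R. e \<otimes>\<^bsub>R\<^esub> e = e}"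

(* "Abelian" refers to the idempotents only; it has nothing to do with the
   locales abelian_group and abelian_monoid for the additive structure. *)
definition idempotents_central :: "('a, 'b) ring_scheme \<Rightarrow> bool" where
  "idempotents_central R \<longleftrightarrow>
    (\<forall>e \<in> idempotent_elems R. \<forall>x \<in> carrier R. e \<otimes>\<^bsub>R\<^esub> x = x \<otimes>\<^bsub>R\<^esub> e)"

locale abelian_ring = ring +
  assumes idempotents_central: "idempotents_central R"

definition unit_regular :: "('a, 'b) ring_scheme \<Rightarrow> bool" where
  "unit_regular R \<longleftrightarrow>
    (\<forall>a \<in> carrier R. \<exists>u \<in> Units R. a = a \<otimes>\<^bsub>R\<^esub> u \<otimes>\<^bsub>R\<^esub> a)"

(* a <# carrier R is the principal right ideal aR. *)
definition special_clean_decomposition ::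
  "('a, 'b) ring_scheme \<Rightarrow> 'a \<Rightarrow> 'a \<Rightarrow> 'a \<Rightarrow> bool" where
  "special_clean_decomposition R a u e \<longleftrightarrow>
    u \<in> Units R \<and> e \<in> idempotent_elems R \<and> a = u \<oplus>\<^bsub>R\<^esub> e \<and>
    (a <#\<^bsub>R\<^esub> carrier R) \<inter> (e <#\<^bsub>R\<^esub> carrier R) = {\<zero>\<^bsub>R\<^esub>}"

definition special_clean :: "('a, 'b) ring_scheme \<Rightarrow> bool" where
  "special_clean R \<longleftrightarrow>
    (\<forall>a \<in> carrier R. \<exists>u e. special_clean_decomposition R a u e)"

(* Uniqueness is that of the pair (u, e). *)
definition uniquely_special_clean :: "('a, 'b) ring_scheme \<Rightarrow> bool" where
  "uniquely_special_clean R \<longleftrightarrow>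
    (\<forall>a \<in> carrier R. \<exists>!d. special_clean_decomposition R a (fst d) (snd d))"

end

theory Submission
  imports Defs
begin

text \<open>
  Since idempotents are central, the condition \<open>aR \<inter> eR = 0\<close> says the same as
  \<open>a e = 0\<close> (\<open>special_clean_decomposition_iff\<close>). Everything else is a
  calculation with this equation.

  If \<open>a = u + e\<close> with \<open>a e = 0\<close>, then \<open>a u\<inverse> a = a u\<inverse> (u + e) = a + a e u\<inverse> = a\<close>, so
  special clean rings are unit-regular. Conversely, if \<open>a = a v a\<close> with \<open>v\<close> a unit, then
  \<open>f = a v\<close> is a central idempotent, \<open>a\<close> is invertible in the corner ring \<open>f R\<close>, and
  \<open>e = 1 - f\<close> annihilates \<open>a\<close>. Thus \<open>a - e\<close> is a unit of \<open>R = f R \<times> e R\<close>, namely the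
  pair of \<open>a\<close> and \<open>- 1\<close>, and \<open>a = (a - e) + e\<close> is a special clean decomposition.

  Uniqueness holds because \<open>e R\<close> is forced to be the right annihilator of \<open>a\<close>
  (\<open>right_annihilator_of_special_clean\<close>), and an ideal is generated by at most one central
  idempotent.
\<close>

context abelian_ring
begin

lemma idempotent_commutes:
  assumes "e \<in> idempotent_elems R" "x \<in> carrier R"
  shows "e \<otimes> x = x \<otimes> e"
  using assms idempotents_central unfolding idempotents_central_def by blast

lemma idempotent_elemsD:
  assumes "e \<in> idempotent_elems R"
  shows "e \<in> carrier R" "e \<otimes> e = e"
  using assms by (simp_all add: idempotent_elems_def)

text \<open>
  The element \<open>a e = e a\<close> lies in both principal right ideals; conversely \<open>a r = e s\<close> is
  fixed by left multiplication with \<open>e\<close>, which sends \<open>a r\<close> to \<open>a e r\<close>.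
\<close>

lemma idempotent_ideal_disjoint_iff:
  assumes a: "a \<in> carrier R" and e: "e \<in> idempotent_elems R"
  shows "(a <# carrier R) \<inter> (e <# carrier R) = {\<zero>} \<longleftrightarrow> a \<otimes> e = \<zero>"
proof
  note eR = idempotent_elemsD[OF e]
  assume disjoint: "(a <# carrier R) \<inter> (e <# carrier R) = {\<zero>}"
  have "a \<otimes> e \<in> a <# carrier R" using eR by (auto simp: l_coset_def)
  moreover have "a \<otimes> e \<in> e <# carrier R"
    using a idempotent_commutes[OF e a, symmetric] by (auto simp: l_coset_def)
  ultimately show "a \<otimes> e = \<zero>" using disjoint by blast
next
  note eR = idempotent_elemsD[OF e]
  assume ae: "a \<otimes> e = \<zero>"
  have "x = \<zero>" if x: "x \<in> a <# carrier R" "x \<in> e <# carrier R" for x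
  proof -
    obtain r s where r: "r \<in> carrier R" "x = a \<otimes> r" and s: "s \<in> carrier R" "x = e \<otimes> s"
      using x by (auto simp: l_coset_def)
    have "x = e \<otimes> x" using s eR by (simp add: m_assoc[symmetric])
    also have "\<dots> = (e \<otimes> a) \<otimes> r" using r a eR by (simp add: m_assoc)
    also have "\<dots> = \<zero>" using idempotent_commutes[OF e a] ae r by simp
    finally show ?thesis .
  qed
  moreover have "\<zero> \<in> b <# carrier R" if "b \<in> carrier R" for b
    unfolding l_coset_def using that by (auto intro!: bexI[of _ \<zero>])
  ultimately show "(a <# carrier R) \<inter> (e <# carrier R) = {\<zero>}" using a eR(1) by blast
qed

lemma special_clean_decomposition_iff:
  "special_clean_decomposition R a u e \<longleftrightarrow>
    u \<in> Units R \<and> e \<in> idempotent_elems R \<and> a = u \<oplus> e \<and> a \<otimes> e = \<zero>"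
proof -
  have "u \<oplus> e \<in> carrier R" if "u \<in> Units R" "e \<in> idempotent_elems R"
    using that idempotent_elemsD by (simp add: Units_closed)
  then show ?thesis
    unfolding special_clean_decomposition_def
    using idempotent_ideal_disjoint_iff by blast
qed

lemma special_clean_imp_unit_regular:
  assumes "special_clean R"
  shows "unit_regular R"
  unfolding unit_regular_def
proof
  fix a assume a: "a \<in> carrier R"
  obtain u e where u: "u \<in> Units R" and e: "e \<in> idempotent_elems R"
    and sum: "a = u \<oplus> e" and ae: "a \<otimes> e = \<zero>"
    using assms a unfolding special_clean_def special_clean_decomposition_iff by blast
  define v where "v = inv u"
  have v: "v \<in> Units R" "v \<in> carrier R" "v \<otimes> u = \<one>" and uR: "u \<in> carrier R"
    using u by (simp_all add: v_def Units_closed)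
  note eR = idempotent_elemsD[OF e]
  have "a \<otimes> v \<otimes> e = a \<otimes> (e \<otimes> v)"
    using a v eR idempotent_commutes[OF e v(2)] by (simp add: m_assoc)
  also have "\<dots> = \<zero>" using a v eR ae by (simp add: m_assoc[symmetric])
  finally have ave: "a \<otimes> v \<otimes> e = \<zero>" .
  have "a \<otimes> v \<otimes> a = a \<otimes> v \<otimes> (u \<oplus> e)" using sum by simp
  also have "\<dots> = a \<otimes> (v \<otimes> u) \<oplus> a \<otimes> v \<otimes> e"
    using a v uR eR by (simp add: r_distr m_assoc)
  also have "\<dots> = a" using ave v a by simp
  finally show "\<exists>u\<in>Units R. a = a \<otimes> u \<otimes> a" using v(1) by force
qed

text \<open>
  The unit \<open>a - (1 - a v)\<close> is \<open>a\<close> on the corner of \<open>a v\<close> and \<open>- 1\<close> on the complementary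
  corner, so its inverse is built from \<open>v\<close> and \<open>- 1\<close> in the same way. That \<open>v\<close> inverts \<open>a\<close>
  on both sides needs \<open>v a = a v\<close>; this holds because both are central idempotents that
  fix \<open>a\<close>, so that \<open>(v a)(a v)\<close> equals each of them.
\<close>

lemma special_clean_decomposition_of_unit_regular:
  assumes a: "a \<in> carrier R" and v: "v \<in> Units R" and ava: "a = a \<otimes> v \<otimes> a"
  shows "special_clean_decomposition R a (a \<ominus> (\<one> \<ominus> a \<otimes> v)) (\<one> \<ominus> a \<otimes> v)"
proof -
  have vR: "v \<in> carrier R" using v by (rule Units_closed)
  define f where "f = a \<otimes> v"
  define g where "g = v \<otimes> a"
  define e where "e = \<one> \<ominus> f"
  have fR: "f \<in> carrier R" and gR: "g \<in> carrier R" and eR: "e \<in> carrier R"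
    using a vR by (simp_all add: f_def g_def e_def)
  have fa: "f \<otimes> a = a" using ava f_def by simp
  have ag: "a \<otimes> g = a" using ava a vR by (simp add: g_def m_assoc)
  have f: "f \<in> idempotent_elems R"
    using fR fa a vR unfolding idempotent_elems_def
    by simp (simp add: f_def m_assoc[symmetric])
  have g: "g \<in> idempotent_elems R"
    using gR ag a vR unfolding idempotent_elems_def
    by simp (simp add: g_def m_assoc)
  note f_comm = idempotent_commutes[OF f]
  have af: "a \<otimes> f = a" using f_comm[OF a] fa by simp
  have "g \<otimes> f = a \<otimes> g \<otimes> v"
    using a vR gR idempotent_commutes[OF g a] by (simp add: f_def m_assoc[symmetric])
  then have "g \<otimes> f = f" using ag by (simp add: f_def)
  moreover have "g \<otimes> f = g"
    using a vR fR af by (simp add: g_def m_assoc)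
  ultimately have va: "v \<otimes> a = f" by (simp add: g_def)
  have ff: "f \<otimes> f = f" using f by (simp add: idempotent_elems_def)
  have fe: "f \<otimes> e = \<zero>" and ef: "e \<otimes> f = \<zero>"
    using fR ff by (simp_all add: e_def minus_eq r_distr l_distr r_minus l_minus r_neg)
  have ee: "e \<otimes> e = e"
    using fR eR fe by (subst (1) e_def) (simp add: minus_eq l_distr l_minus)
  then have e: "e \<in> idempotent_elems R" using eR by (simp add: idempotent_elems_def)
  have ae: "a \<otimes> e = \<zero>"
    using a fR af by (simp add: e_def minus_eq r_distr r_minus r_neg)
  have ea: "e \<otimes> a = \<zero>" using idempotent_commutes[OF e a] ae by simp
  have fe1: "f \<oplus> e = \<one>" using fR unfolding e_def by algebra
  define w where "w = v \<otimes> f \<ominus> e"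
  have wR: "w \<in> carrier R" using vR fR eR by (simp add: w_def)
  have evf: "e \<otimes> (v \<otimes> f) = \<zero>"
    using eR fR vR ef by (simp add: f_comm[OF vR, symmetric]) (simp add: m_assoc[symmetric])
  have avf: "a \<otimes> (v \<otimes> f) = f"
    using a vR fR ff by (simp add: m_assoc[symmetric] f_def)
  have vfa: "v \<otimes> f \<otimes> a = f" using vR fR a fa va by (simp add: m_assoc)
  have vfe: "v \<otimes> f \<otimes> e = \<zero>" using vR fR eR fe by (simp add: m_assoc)
  have "(a \<ominus> e) \<otimes> w = \<one>"
    using a eR vR fR avf evf ae ee fe1
    by (simp add: w_def minus_eq r_distr l_distr r_minus l_minus)
  moreover have "w \<otimes> (a \<ominus> e) = \<one>"
    using a eR vR fR vfa vfe ea ee fe1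
    by (simp add: w_def minus_eq r_distr l_distr r_minus l_minus)
  ultimately have "a \<ominus> e \<in> Units R"
    using wR a eR unfolding Units_def by auto
  moreover have "a = (a \<ominus> e) \<oplus> e" using a eR by algebra
  ultimately have "special_clean_decomposition R a (a \<ominus> e) e"
    unfolding special_clean_decomposition_iff using e ae by blast
  then show ?thesis by (simp add: e_def f_def)
qed

text \<open>
  From \<open>0 = a e = u e + e\<close> it follows that \<open>e x = - u e x\<close>, so \<open>a x = 0\<close> reads
  \<open>u x = u e x\<close>, and \<open>u\<close> can be cancelled.
\<close>

lemma right_annihilator_of_special_clean:
  assumes d: "special_clean_decomposition R a u e"
    and x: "x \<in> carrier R" and ax: "a \<otimes> x = \<zero>"
  shows "e \<otimes> x = x"
proof -
  have u: "u \<in> Units R" and e: "e \<in> idempotent_elems R"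
    and sum: "a = u \<oplus> e" and ae: "a \<otimes> e = \<zero>"
    using d unfolding special_clean_decomposition_iff by blast+
  note eR = idempotent_elemsD[OF e]
  have uR: "u \<in> carrier R" using u by (rule Units_closed)
  have "(u \<oplus> e) \<otimes> e \<otimes> x = \<zero>" using ae sum x by simp
  then have "u \<otimes> (e \<otimes> x) \<oplus> e \<otimes> x = \<zero>"
    using uR eR x by (simp add: l_distr m_assoc)
  moreover have "u \<otimes> x \<oplus> e \<otimes> x = \<zero>" using ax sum uR eR x by (simp add: l_distr)
  ultimately have "u \<otimes> (e \<otimes> x) \<oplus> e \<otimes> x = u \<otimes> x \<oplus> e \<otimes> x" by simp
  then have "u \<otimes> (e \<otimes> x) = u \<otimes> x"
    using uR eR x by simp
  then show ?thesis using u eR x by simp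
qed

lemma special_clean_decomposition_unique:
  assumes d: "special_clean_decomposition R a u e"
    and d': "special_clean_decomposition R a u' e'"
  shows "u = u'" "e = e'"
proof -
  have e: "e \<in> idempotent_elems R" "a \<otimes> e = \<zero>" and e': "e' \<in> idempotent_elems R" "a \<otimes> e' = \<zero>"
    and sum: "a = u \<oplus> e" "a = u' \<oplus> e'" and u: "u \<in> carrier R" "u' \<in> carrier R"
    using d d' by (auto simp: special_clean_decomposition_iff)
  note eR = idempotent_elemsD(1)[OF e(1)] and eR' = idempotent_elemsD(1)[OF e'(1)]
  have "e = e' \<otimes> e" using right_annihilator_of_special_clean[OF d' eR e(2)] by simp
  also have "\<dots> = e \<otimes> e'" using idempotent_commutes[OF e'(1) eR] .
  also have "\<dots> = e'" using right_annihilator_of_special_clean[OF d eR' e'(2)] .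
  finally show "e = e'" .
  then show "u = u'" using sum u eR by auto
qed

lemma unit_regular_imp_uniquely_special_clean:
  assumes "unit_regular R"
  shows "uniquely_special_clean R"
  unfolding uniquely_special_clean_def
proof
  fix a assume a: "a \<in> carrier R"
  obtain v where "v \<in> Units R" "a = a \<otimes> v \<otimes> a"
    using assms a unfolding unit_regular_def by blast
  then obtain u e where d: "special_clean_decomposition R a u e"
    using special_clean_decomposition_of_unit_regular[OF a] by blast
  show "\<exists>!d. special_clean_decomposition R a (fst d) (snd d)"
  proof
    show "special_clean_decomposition R a (fst (u, e)) (snd (u, e))" using d by simp
    show "d' = (u, e)" if "special_clean_decomposition R a (fst d') (snd d')" for d'
      using special_clean_decomposition_unique[OF that d] by (simp add: prod_eq_iff)
  qed
qed

end

lemma uniquely_special_clean_imp_special_clean: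
  "uniquely_special_clean R \<Longrightarrow> special_clean R"
  unfolding uniquely_special_clean_def special_clean_def by blast

theorem proposition4p1:
  fixes R :: "('a, 'b) ring_scheme"
  assumes "abelian_ring R"
  shows "(unit_regular R \<longleftrightarrow> uniquely_special_clean R) \<and>
         (unit_regular R \<longleftrightarrow> special_clean R)"
  using abelian_ring.special_clean_imp_unit_regular[OF assms]
    abelian_ring.unit_regular_imp_uniquely_special_clean[OF assms]
    uniquely_special_clean_imp_special_clean[of R]
  by blast

end
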